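(* Let $G=(V,E)$ be a simple graph with maximum degree $\Delta>1$, and let $s\ge1$ be a fixed integer. For integers $k>2$ with $1\le s\le\lfloor\frac{k-1}{2}\rfloor$, let $\mathscr{Q}^{k,s}$ be the signless Laplacian tensor of the generalized power hypergraph $G^{k,s}$. Then $\lim_{k\to\infty}\lambda(\mathscr{Q}^{k,s})=\Delta$.
   Context: Generalized power hypergraph: for a simple graph $G=(V,E)$, an integer $k\ge2$ and $1\le s\le k/2$, $G^{k,s}$ is the $k$-uniform hypergraph obtained by taking, for each $v\in V$, a set $V_v$ of $s$ new vertices and, for each $e\in E$, a set $V_e$ of $k-2s$ new vertices (all pairwise disjoint), with vertex set $\bigcup_vV_v\cup\bigcup_eV_e$ and edge set $\{V_u\cup V_v\cup V_e:e=uv\in E\}$. Its adjacency tensor $\mathscr{A}^{k,s}$ is the order $k$ tensor indexed by the vertex set with entry $\frac1{(k-1)!}$ at $(i_1,\dots,i_k)$ if $\{i_1,\dots,i_k\}$ is an edge and $0$ otherwise; the signless Laplacian tensor is $\mathscr{Q}^{k,s}=\mathscr{D}^{k,s}+\mathscr{A}^{k,s}$ with $\mathscr{D}^{k,s}$ the diagonal tensor of vertex degrees. For an order $k$ tensor $\mathscr{T}$ indexed by a finite set $N$, $(\mathscr{T}x)_i=\sum_{i_2,\dots,i_k}t_{ii_2\cdots i_k}x_{i_2}\cdots x_{i_k}$; $\lambda\in\mathbb{R}$ is an $H$-eigenvalue if $\mathscr{T}x=\lambda x^{[k-1]}$ for some nonzero real $x$ (with $x^{[k-1]}_i=x_i^{k-1}$);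 $\lambda(\mathscr{T})$ is the largest $H$-eigenvalue. *)

theory Defs
  imports Complex_Main
begin

definition simple_graph :: "'a set \<Rightarrow> 'a set set \<Rightarrow> bool" where
  "simple_graph V E \<longleftrightarrow> finite V \<and> V \<noteq> {} \<and> (\<forall>e\<in>E. e \<subseteq> V \<and> card e = 2)"

text \<open>Shared by graphs and hypergraphs, both given by their sets of edges.\<close>

definition degree :: "'b set set \<Rightarrow> 'b \<Rightarrow> nat" where
  "degree E v = card {e \<in> E. v \<in> e}"

definition max_degree :: "'a set \<Rightarrow> 'a set set \<Rightarrow> nat" where
  "max_degree V E = Max (degree E ` V)"

text \<open>The vertices of a generalized power hypergraph: the \<open>i\<close>-th element of $V_v$ is
  \<open>Vert_Copy v i\<close>, and the \<open>i\<close>-th element of $V_e$ is \<open>Edge_Copy e i\<close>.\<close>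

datatype 'a power_vertex = Vert_Copy 'a nat | Edge_Copy "'a set" nat

definition vert_block :: "nat \<Rightarrow> 'a \<Rightarrow> 'a power_vertex set" where
  "vert_block s v = Vert_Copy v ` {..<s}"

definition edge_block :: "nat \<Rightarrow> nat \<Rightarrow> 'a set \<Rightarrow> 'a power_vertex set" where
  "edge_block k s e = Edge_Copy e ` {..<k - 2 * s}"

definition power_vertices :: "'a set \<Rightarrow> 'a set set \<Rightarrow> nat \<Rightarrow> nat \<Rightarrow> 'a power_vertex set" where
  "power_vertices V E k s = (\<Union>v\<in>V. vert_block s v) \<union> (\<Union>e\<in>E. edge_block k s e)"

definition power_edges :: "'a set set \<Rightarrow> nat \<Rightarrow> nat \<Rightarrow> 'a power_vertex set set" where
  "power_edges E k s =
     {vert_block s u \<union> vert_block s v \<union> edge_block k s {u, v} | u v. {u, v} \<in> E}"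

text \<open>An order \<open>k\<close> tensor indexed by a finite set \<open>N\<close> is a function on lists; only its values
  on lists of length \<open>k\<close> with entries in \<open>N\<close> matter.\<close>

type_synonym 'b tensor = "'b list \<Rightarrow> real"

definition adjacency_tensor :: "nat \<Rightarrow> 'b set set \<Rightarrow> 'b tensor" where
  "adjacency_tensor k E is = (if set is \<in> E then 1 / fact (k - 1) else 0)"

definition degree_tensor :: "nat \<Rightarrow> 'b set set \<Rightarrow> 'b tensor" where
  "degree_tensor k E is = (if is = replicate k (hd is) then real (degree E (hd is)) else 0)"

definition signless_laplacian_tensor :: "nat \<Rightarrow> 'b set set \<Rightarrow> 'b tensor" where
  "signless_laplacian_tensor k E is = degree_tensor k E is + adjacency_tensor k E is"

definition tensor_apply :: "'b set \<Rightarrow> nat \<Rightarrow> 'b tensor \<Rightarrow> ('b \<Rightarrow> real) \<Rightarrow> 'b \<Rightarrow> real" where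
  "tensor_apply N k T x i =
     (\<Sum>js | set js \<subseteq> N \<and> length js = k - 1. T (i # js) * prod_list (map x js))"

definition H_eigenvalue :: "'b set \<Rightarrow> nat \<Rightarrow> 'b tensor \<Rightarrow> real \<Rightarrow> bool" where
  "H_eigenvalue N k T l \<longleftrightarrow>
     (\<exists>x. (\<exists>i\<in>N. x i \<noteq> 0) \<and> (\<forall>i\<in>N. tensor_apply N k T x i = l * x i ^ (k - 1)))"

definition largest_H_eigenvalue :: "'b set \<Rightarrow> nat \<Rightarrow> 'b tensor \<Rightarrow> real" where
  "largest_H_eigenvalue N k T = (GREATEST l. H_eigenvalue N k T l)"

end

theory Submission
  imports Defs "HOL-Combinatorics.Multiset_Permutations"
begin

text \<open>
  For a \<open>k\<close>-uniform hypergraph an eigenpair \<open>(l, x)\<close> of the signless Laplacian tensor satisfies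
  \<open>(l - d\<^sub>i) x\<^sub>i\<^sup>k = (\<Sum>e\<ni>i. x\<^sup>e)\<close>, where \<open>x\<^sup>e\<close> is the product of \<open>x\<close> over the edge \<open>e\<close>.
  If \<open>k \<ge> 3\<close>, unit vectors are eigenvectors, so every degree, in particular \<open>\<Delta>\<close>, is an eigenvalue.
  Conversely let \<open>l \<ge> \<Delta> + \<epsilon>\<close> and let \<open>e\<close> be an edge of the power hypergraph at which \<open>P = \<bar>x\<^sup>e\<bar>\<close>
  is maximal. The \<open>2s\<close> vertices of \<open>e\<close> in vertex blocks satisfy \<open>\<bar>x\<^sub>i\<bar>\<^sup>k \<le> \<Delta> P / \<epsilon>\<close> and the
  \<open>k - 2s\<close> vertices of degree one satisfy \<open>\<bar>x\<^sub>i\<bar>\<^sup>k = P / (l - 1)\<close>. Multiplying these bounds over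
  \<open>e\<close> gives \<open>(1 + \<epsilon>)\<^bsup>k-2s\<^esup> \<le> (l - 1)\<^bsup>k-2s\<^esup> \<le> (\<Delta> / \<epsilon>)\<^bsup>2s\<^esup>\<close>, which fails for large \<open>k\<close>.
  A largest eigenvalue exists because the set of eigenvalues is closed, by compactness of the
  unit sphere.
\<close>

section \<open>Existence of a largest H-eigenvalue\<close>

lemma bounded_real_convergent_subseq:
  fixes f :: "nat \<Rightarrow> real"
  assumes "\<And>n. \<bar>f n\<bar> \<le> B"
  shows "\<exists>r l. strict_mono r \<and> (\<lambda>n. f (r n)) \<longlonglongrightarrow> l"
proof -
  obtain r :: "nat \<Rightarrow> nat" where r: "strict_mono r" "monoseq (\<lambda>n. f (r n))"
    using seq_monosub[of f] by blast
  have "Bseq (\<lambda>n. f (r n))"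
    using assms by (intro BseqI'[where K = B]) simp
  then show ?thesis
    using r Bseq_monoseq_convergent by (auto simp: convergent_def)
qed

text \<open>Induction on \<open>N\<close>: each new coordinate costs one further subsequence, and
  the coordinates treated earlier keep their limits along it.\<close>

lemma bounded_family_convergent_subseq:
  fixes X :: "nat \<Rightarrow> 'b \<Rightarrow> real"
  assumes "finite N" "\<And>n i. i \<in> N \<Longrightarrow> \<bar>X n i\<bar> \<le> B"
  shows "\<exists>r l. strict_mono r \<and> (\<forall>i\<in>N. (\<lambda>n. X (r n) i) \<longlonglongrightarrow> l i)"
  using assms
proof (induction N rule: finite_induct)
  case empty
  then show ?case using strict_mono_id by auto
next
  case (insert a N)
  then obtain r l where r: "strict_mono r" "\<forall>i\<in>N. (\<lambda>n. X (r n) i) \<longlonglongrightarrow> l i"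
    by auto
  obtain q m where q: "strict_mono q" "(\<lambda>n. X (r (q n)) a) \<longlonglongrightarrow> m"
    using bounded_real_convergent_subseq[of "\<lambda>n. X (r n) a" B] insert.prems by auto
  have "(\<lambda>n. X (r (q n)) i) \<longlonglongrightarrow> l i" if "i \<in> N" for i
    using LIMSEQ_subseq_LIMSEQ[OF r(2)[rule_format, OF that] q(1)] by (simp add: o_def)
  then have "\<forall>i\<in>insert a N. (\<lambda>n. X ((r \<circ> q) n) i) \<longlonglongrightarrow> (l(a := m)) i"
    using q(2) insert.hyps by auto
  then show ?case
    using strict_mono_o[OF r(1) q(1)] by blast
qed

section \<open>Continuity and homogeneity of \<open>tensor_apply\<close>\<close>

lemma tendsto_prod_list_map:
  fixes X :: "nat \<Rightarrow> 'b \<Rightarrow> real"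
  assumes "\<And>i. i \<in> set js \<Longrightarrow> (\<lambda>n. X n i) \<longlonglongrightarrow> y i"
  shows "(\<lambda>n. prod_list (map (X n) js)) \<longlonglongrightarrow> prod_list (map y js)"
  using assms by (induction js) (auto intro!: tendsto_mult)

lemma tendsto_tensor_apply:
  assumes "\<And>i. i \<in> N \<Longrightarrow> (\<lambda>n. X n i) \<longlonglongrightarrow> y i"
  shows "(\<lambda>n. tensor_apply N k T (X n) i) \<longlonglongrightarrow> tensor_apply N k T y i"
  unfolding tensor_apply_def
  using assms by (intro tendsto_sum tendsto_mult tendsto_const tendsto_prod_list_map) auto

lemma prod_list_map_scale:
  fixes c :: real
  shows "prod_list (map (\<lambda>i. c * x i) js) = c ^ length js * prod_list (map x js)"
  by (induction js) auto

lemma tensor_apply_scale: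
  "tensor_apply N k T (\<lambda>i. c * x i) j = c ^ (k - 1) * tensor_apply N k T x j"
  unfolding tensor_apply_def sum_distrib_left
  by (rule sum.cong) (auto simp: prod_list_map_scale)

text \<open>Both sides of the eigenvalue equation are homogeneous of degree \<open>k - 1\<close>, so
  eigenvectors may be rescaled. The unit l1 norm bounds all coordinates and survives limits.\<close>

lemma H_eigenvalue_normalized:
  assumes "finite N" "H_eigenvalue N k T l"
  obtains x where "(\<Sum>i\<in>N. \<bar>x i\<bar>) = 1"
    and "\<And>i. i \<in> N \<Longrightarrow> tensor_apply N k T x i = l * x i ^ (k - 1)"
proof -
  obtain x j where j: "j \<in> N" "x j \<noteq> 0"
    and x: "\<And>i. i \<in> N \<Longrightarrow> tensor_apply N k T x i = l * x i ^ (k - 1)"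
    using assms(2) by (auto simp: H_eigenvalue_def)
  define c where "c = 1 / (\<Sum>i\<in>N. \<bar>x i\<bar>)"
  have "(\<Sum>i\<in>N. \<bar>x i\<bar>) > 0"
    using j by (intro sum_pos2[OF assms(1) j(1)]) auto
  then have "(\<Sum>i\<in>N. \<bar>c * x i\<bar>) = 1"
    by (simp add: c_def abs_mult flip: sum_divide_distrib)
  moreover have "tensor_apply N k T (\<lambda>i. c * x i) i = l * (c * x i) ^ (k - 1)" if "i \<in> N" for i
    by (simp add: tensor_apply_scale x[OF that] power_mult_distrib)
  ultimately show thesis by (rule that)
qed

lemma H_eigenvalue_limit:
  assumes "finite N" "\<And>n. H_eigenvalue N k T (f n)" "f \<longlonglongrightarrow> L"
  shows "H_eigenvalue N k T L"
proof -
  have "\<forall>n. \<exists>x. (\<Sum>i\<in>N. \<bar>x i\<bar>) = 1 \<and> (\<forall>i\<in>N. tensor_apply N k T x i = f n * x i ^ (k - 1))"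
    using H_eigenvalue_normalized[OF assms(1,2)] by metis
  then obtain X where X1: "\<And>n. (\<Sum>i\<in>N. \<bar>X n i\<bar>) = 1"
    and X2: "\<And>n i. i \<in> N \<Longrightarrow> tensor_apply N k T (X n) i = f n * X n i ^ (k - 1)"
    by metis
  have "\<bar>X n i\<bar> \<le> 1" if "i \<in> N" for n i
    using member_le_sum[OF that, of "\<lambda>i. \<bar>X n i\<bar>"] assms(1) X1[of n] by auto
  then obtain r y where r: "strict_mono r"
    and y: "\<And>i. i \<in> N \<Longrightarrow> (\<lambda>n. X (r n) i) \<longlonglongrightarrow> y i"
    using bounded_family_convergent_subseq[OF assms(1), of X 1] by blast
  have "(\<lambda>n. \<Sum>i\<in>N. \<bar>X (r n) i\<bar>) \<longlonglongrightarrow> (\<Sum>i\<in>N. \<bar>y i\<bar>)"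
    using y by (intro tendsto_sum tendsto_rabs)
  then have "(\<Sum>i\<in>N. \<bar>y i\<bar>) = 1"
    by (simp add: X1 LIMSEQ_const_iff)
  \<comment> \<open>The normalization keeps the limit vector from degenerating to zero.\<close>
  then have "\<exists>i\<in>N. y i \<noteq> 0"
    by (metis abs_zero sum.neutral zero_neq_one)
  moreover have "tensor_apply N k T y i = L * y i ^ (k - 1)" if "i \<in> N" for i
  proof (rule LIMSEQ_unique)
    show "(\<lambda>n. tensor_apply N k T (X (r n)) i) \<longlonglongrightarrow> tensor_apply N k T y i"
      using y by (rule tendsto_tensor_apply)
    have "(\<lambda>n. f (r n)) \<longlonglongrightarrow> L"
      using LIMSEQ_subseq_LIMSEQ[OF assms(3) r] by (simp add: o_def)
    then show "(\<lambda>n. tensor_apply N k T (X (r n)) i) \<longlonglongrightarrow> L * y i ^ (k - 1)"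
      unfolding X2[OF that] using y[OF that] by (intro tendsto_mult tendsto_power)
  qed
  ultimately show ?thesis by (auto simp: H_eigenvalue_def)
qed

text \<open>\<open>GREATEST\<close> is informative only if a maximum is attained. The supremum of
  the eigenvalues is a limit of eigenvalues, hence an eigenvalue itself by
  \<open>H_eigenvalue_limit\<close>.\<close>

lemma largest_H_eigenvalue_exists:
  assumes "finite N" "H_eigenvalue N k T l0" "\<And>l. H_eigenvalue N k T l \<Longrightarrow> l \<le> B"
  shows "H_eigenvalue N k T (largest_H_eigenvalue N k T)"
    and "\<And>l. H_eigenvalue N k T l \<Longrightarrow> l \<le> largest_H_eigenvalue N k T"
proof -
  define S where "S = {l. H_eigenvalue N k T l}"
  have S: "S \<noteq> {}" "bdd_above S"
    using assms by (auto simp: S_def bdd_above_def)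
  have "\<exists>l\<in>S. Sup S - 1 / real (Suc n) < l" for n
    using S by (subst less_cSup_iff[symmetric]) auto
  then obtain f where f: "\<And>n. f n \<in> S" "\<And>n. Sup S - 1 / real (Suc n) < f n"
    by metis
  have "f \<longlonglongrightarrow> Sup S"
  proof (rule tendsto_sandwich)
    show "(\<lambda>n. Sup S - 1 / real (Suc n)) \<longlonglongrightarrow> Sup S"
      using tendsto_diff[OF tendsto_const LIMSEQ_inverse_real_of_nat, of "Sup S"]
      by (simp add: inverse_eq_divide)
    show "\<forall>\<^sub>F n in sequentially. Sup S - 1 / real (Suc n) \<le> f n"
      using less_imp_le[OF f(2)] by (intro always_eventually allI)
    show "\<forall>\<^sub>F n in sequentially. f n \<le> Sup S"
      using cSup_upper[OF f(1) S(2)] by (intro always_eventually allI)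
  qed simp
  then have *: "H_eigenvalue N k T (Sup S)"
    using f(1) H_eigenvalue_limit[OF assms(1), of k T f] by (simp add: S_def)
  have **: "l \<le> Sup S" if "H_eigenvalue N k T l" for l
    using that S by (intro cSup_upper) (auto simp: S_def)
  have "largest_H_eigenvalue N k T = Sup S"
    unfolding largest_H_eigenvalue_def using * ** by (rule Greatest_equality)
  then show "H_eigenvalue N k T (largest_H_eigenvalue N k T)"
    "\<And>l. H_eigenvalue N k T l \<Longrightarrow> l \<le> largest_H_eigenvalue N k T"
    using * ** by auto
qed

section \<open>The signless Laplacian tensor of a uniform hypergraph\<close>

lemma tensor_apply_degree_tensor:
  assumes "finite N" "i \<in> N" "k \<ge> 1"
  shows "tensor_apply N k (degree_tensor k H) x i = real (degree H i) * x i ^ (k - 1)"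
proof -
  have rep: "i # js = replicate k i \<longleftrightarrow> js = replicate (k - 1) i" for js
    using assms(3) by (cases k) auto
  have fin: "finite {js. set js \<subseteq> N \<and> length js = k - 1}"
    using assms(1) by (rule finite_lists_length_eq)
  have "tensor_apply N k (degree_tensor k H) x i =
      (\<Sum>js | set js \<subseteq> N \<and> length js = k - 1.
        if js = replicate (k - 1) i then real (degree H i) * x i ^ (k - 1) else 0)"
    unfolding tensor_apply_def
    by (rule sum.cong) (auto simp: degree_tensor_def rep map_replicate prod_list_replicate simp del: replicate_Suc)
  also have "\<dots> = real (degree H i) * x i ^ (k - 1)"
    using assms(2) fin by (subst sum.delta) auto
  finally show ?thesis .
qed

text \<open>A list of length \<open>k\<close> covering a set of \<open>k\<close> elements has no
  repetition, so the tails are exactly the orderings of the remaining vertices.\<close>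

lemma lists_completing_to_edge:
  assumes "card e = k" "finite e" "i \<in> e" "k \<ge> 1"
  shows "{js. length js = k - 1 \<and> set (i # js) = e} = permutations_of_set (e - {i})"
proof (intro equalityI subsetI)
  fix js assume "js \<in> {js. length js = k - 1 \<and> set (i # js) = e}"
  then have js: "length (i # js) = k" "set (i # js) = e"
    using assms(4) by auto
  then have "distinct (i # js)"
    using assms(1) by (metis card_distinct)
  then show "js \<in> permutations_of_set (e - {i})"
    using js by (auto simp: permutations_of_set_def)
next
  fix js assume "js \<in> permutations_of_set (e - {i})"
  then have js: "set js = e - {i}" "distinct js"
    by (auto simp: permutations_of_set_def)
  then have "length js = k - 1"
    using assms by (metis card_Diff_singleton distinct_card)
  then show "js \<in> {js. length js = k - 1 \<and> set (i # js) = e}"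
    using js assms by auto
qed

text \<open>Index lists are grouped by the edge they cover. Each edge through \<open>i\<close>
  arises from \<open>fact (k - 1)\<close> lists with the same product, which cancels the entry
  \<open>1 / fact (k - 1)\<close>.\<close>

lemma tensor_apply_adjacency_tensor:
  assumes "finite N" "i \<in> N" "k \<ge> 1" "finite H"
    and edges: "\<And>e. e \<in> H \<Longrightarrow> e \<subseteq> N \<and> card e = k"
  shows "tensor_apply N k (adjacency_tensor k H) x i =
    (\<Sum>e | e \<in> H \<and> i \<in> e. \<Prod>j\<in>e - {i}. x j)"
proof -
  let ?A = "{js. set js \<subseteq> N \<and> length js = k - 1}"
  let ?B = "{js \<in> ?A. set (i # js) \<in> H}"
  let ?h = "\<lambda>js. 1 / fact (k - 1) * prod_list (map x js)"
  have fin: "finite ?A"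
    using assms(1) by (rule finite_lists_length_eq)
  have "tensor_apply N k (adjacency_tensor k H) x i = (\<Sum>js\<in>?A. if set (i # js) \<in> H then ?h js else 0)"
    unfolding tensor_apply_def adjacency_tensor_def by (rule sum.cong) auto
  also have "\<dots> = (\<Sum>js\<in>?B. ?h js)"
    using sum.inter_filter[OF fin, of ?h "\<lambda>js. set (i # js) \<in> H"] by simp
  also have "\<dots> = (\<Sum>e | e \<in> H \<and> i \<in> e. \<Sum>js\<in>{js \<in> ?B. set (i # js) = e}. ?h js)"
    using finite_subset[OF _ fin, of ?B] assms(4) by (intro sum.group[symmetric]) auto
  also have "\<dots> = (\<Sum>e | e \<in> H \<and> i \<in> e. \<Prod>j\<in>e - {i}. x j)"
  proof (rule sum.cong[OF refl])
    fix e assume "e \<in> {e. e \<in> H \<and> i \<in> e}"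
    then have e: "e \<in> H" "i \<in> e" "e \<subseteq> N" "card e = k" "finite e"
      using edges[of e] assms(1) finite_subset by auto
    have "{js \<in> ?B. set (i # js) = e} = {js. length js = k - 1 \<and> set (i # js) = e}"
      using e by auto
    also have "\<dots> = permutations_of_set (e - {i})"
      using e assms(3) by (intro lists_completing_to_edge)
    finally have "(\<Sum>js\<in>{js \<in> ?B. set (i # js) = e}. ?h js) =
        (\<Sum>js\<in>permutations_of_set (e - {i}). 1 / fact (k - 1) * (\<Prod>j\<in>e - {i}. x j))"
      by (intro sum.cong) (auto simp: permutations_of_set_def simp flip: prod.distinct_set_conv_list)
    also have "\<dots> = (\<Prod>j\<in>e - {i}. x j)"
      using e by simp
    finally show "(\<Sum>js\<in>{js \<in> ?B. set (i # js) = e}. ?h js) = (\<Prod>j\<in>e - {i}. x j)" .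
  qed
  finally show ?thesis .
qed

lemma tensor_apply_signless_laplacian:
  assumes "finite N" "i \<in> N" "k \<ge> 1" "finite H"
    and "\<And>e. e \<in> H \<Longrightarrow> e \<subseteq> N \<and> card e = k"
  shows "tensor_apply N k (signless_laplacian_tensor k H) x i =
    real (degree H i) * x i ^ (k - 1) + (\<Sum>e | e \<in> H \<and> i \<in> e. \<Prod>j\<in>e - {i}. x j)"
proof -
  have "tensor_apply N k (signless_laplacian_tensor k H) x i =
      tensor_apply N k (degree_tensor k H) x i + tensor_apply N k (adjacency_tensor k H) x i"
    by (simp add: tensor_apply_def signless_laplacian_tensor_def distrib_right sum.distrib)
  then show ?thesis
    using tensor_apply_degree_tensor[OF assms(1-3)] tensor_apply_adjacency_tensor[OF assms]
    by simp
qed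

text \<open>Multiplying the eigenvalue equation by \<open>x i\<close> completes every product to the
  whole edge. An edge then contributes the same term at each of its vertices, so coordinates along
  an edge become comparable.\<close>

lemma signless_laplacian_eigenequation:
  assumes "finite N" "i \<in> N" "k \<ge> 1" "finite H"
    and edges: "\<And>e. e \<in> H \<Longrightarrow> e \<subseteq> N \<and> card e = k"
    and eig: "tensor_apply N k (signless_laplacian_tensor k H) x i = l * x i ^ (k - 1)"
  shows "(l - real (degree H i)) * x i ^ k = (\<Sum>e | e \<in> H \<and> i \<in> e. \<Prod>j\<in>e. x j)"
proof -
  have "(l - real (degree H i)) * x i ^ (k - 1) = (\<Sum>e | e \<in> H \<and> i \<in> e. \<Prod>j\<in>e - {i}. x j)"
    using eig tensor_apply_signless_laplacian[OF assms(1-5)] by (simp add: left_diff_distrib)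
  then have "(l - real (degree H i)) * (x i * x i ^ (k - 1)) =
      (\<Sum>e | e \<in> H \<and> i \<in> e. x i * (\<Prod>j\<in>e - {i}. x j))"
    by (simp flip: sum_distrib_left)
  also have "\<dots> = (\<Sum>e | e \<in> H \<and> i \<in> e. \<Prod>j\<in>e. x j)"
  proof (rule sum.cong[OF refl])
    fix e assume "e \<in> {e. e \<in> H \<and> i \<in> e}"
    then show "x i * (\<Prod>j\<in>e - {i}. x j) = (\<Prod>j\<in>e. x j)"
      using edges[of e] assms(1) by (intro prod.remove[symmetric]) (auto intro: finite_subset)
  qed
  also have "x i * x i ^ (k - 1) = x i ^ k"
    using assms(3) by (cases k) auto
  finally show ?thesis .
qed

lemma degree_H_eigenvalue_signless_laplacian:
  assumes "finite N" "i \<in> N" "k \<ge> 3" "finite H"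
    and edges: "\<And>e. e \<in> H \<Longrightarrow> e \<subseteq> N \<and> card e = k"
  shows "H_eigenvalue N k (signless_laplacian_tensor k H) (real (degree H i))"
  unfolding H_eigenvalue_def
proof (intro exI[of _ "\<lambda>j. if j = i then 1 else 0"] conjI ballI)
  let ?x = "\<lambda>j. if j = i then 1 else (0::real)"
  fix j assume j: "j \<in> N"
  have "(\<Prod>m\<in>e - {j}. ?x m) = 0" if "e \<in> H" "j \<in> e" for e
  proof -
    have fin: "finite e"
      using edges[OF that(1)] assms(1) finite_subset by blast
    \<comment> \<open>As \<open>k\<close> is at least 3, \<open>e\<close> has a vertex other than
      \<open>i\<close> and \<open>j\<close>; it gives a zero factor in the product. The case
      \<open>i = j\<close> is included.\<close>
    have "card e \<le> card {i, j}" if "e \<subseteq> {i, j}"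
      using that by (intro card_mono) auto
    then have "\<not> e \<subseteq> {i, j}"
      using edges[OF that(1)] assms(3) card_length[of "[i, j]"] by auto
    then show ?thesis
      using fin by (subst prod_zero_iff) auto
  qed
  then have "tensor_apply N k (signless_laplacian_tensor k H) ?x j =
      real (degree H j) * ?x j ^ (k - 1)"
    using assms j by (subst tensor_apply_signless_laplacian) (auto intro!: sum.neutral)
  then show "tensor_apply N k (signless_laplacian_tensor k H) ?x j =
      real (degree H i) * ?x j ^ (k - 1)"
    using assms(3) by auto
qed (use assms(2) in auto)

section \<open>Generalized power hypergraphs\<close>

text \<open>Indexing by the edge instead of its two endpoints avoids ordering them and makes
  \<open>power_edges\<close> an image of \<open>E\<close>, so sums over hyperedges become sums over
  \<open>E\<close>.\<close>

definition power_edge :: "nat \<Rightarrow> nat \<Rightarrow> 'a set \<Rightarrow> 'a power_vertex set" where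
  "power_edge k s e = (\<Union>v\<in>e. vert_block s v) \<union> edge_block k s e"

lemma power_edges_eq_image:
  assumes "simple_graph V E"
  shows "power_edges E k s = power_edge k s ` E"
proof (intro equalityI subsetI)
  fix h assume "h \<in> power_edges E k s"
  then obtain u v where "{u, v} \<in> E" "h = power_edge k s {u, v}"
    unfolding power_edges_def power_edge_def by auto
  then show "h \<in> power_edge k s ` E"
    by simp
next
  fix h assume "h \<in> power_edge k s ` E"
  then obtain e where e: "e \<in> E" "h = power_edge k s e"
    by auto
  then have "card e = 2"
    using assms by (simp add: simple_graph_def)
  then obtain u v where "e = {u, v}"
    by (auto simp: card_2_iff)
  then show "h \<in> power_edges E k s"
    using e unfolding power_edges_def power_edge_def by auto
qed

lemma Vert_Copy_in_power_edge [simp]: "Vert_Copy v i \<in> power_edge k s e \<longleftrightarrow> v \<in> e \<and> i < s"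
  by (auto simp: power_edge_def vert_block_def edge_block_def)

lemma Edge_Copy_in_power_edge [simp]:
  "Edge_Copy f i \<in> power_edge k s e \<longleftrightarrow> f = e \<and> i < k - 2 * s"
  by (auto simp: power_edge_def vert_block_def edge_block_def)

lemma inj_power_edge:
  assumes "s \<ge> 1"
  shows "inj (power_edge k s)"
proof (rule injI)
  fix e f :: "'a set" assume "power_edge k s e = power_edge k s f"
  \<comment> \<open>Since \<open>s\<close> is positive, the copy with index 0 exists and detects
    whether \<open>v\<close> lies in the edge.\<close>
  then have "Vert_Copy v 0 \<in> power_edge k s e \<longleftrightarrow> Vert_Copy v 0 \<in> power_edge k s f" for v
    by simp
  then show "e = f" using assms by auto
qed

lemma card_vert_blocks:
  assumes "finite e"
  shows "card (\<Union>v\<in>e. vert_block s v) = card e * s"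
proof -
  have "card (vert_block s v) = s" for v :: 'a
    by (simp add: vert_block_def card_image inj_on_def)
  then show ?thesis
    using assms by (subst card_UN_disjoint) (auto simp: vert_block_def)
qed

lemma card_edge_block: "card (edge_block k s e) = k - 2 * s"
  by (simp add: edge_block_def card_image inj_on_def)

lemma finite_blocks:
  assumes "finite e"
  shows "finite (\<Union>v\<in>e. vert_block s v)" "finite (edge_block k s e)"
  using assms by (auto simp: vert_block_def edge_block_def)

lemma vert_edge_blocks_disjoint: "(\<Union>v\<in>e. vert_block s v) \<inter> edge_block k s e = {}"
  by (auto simp: vert_block_def edge_block_def)

lemma card_power_edge:
  assumes "card e = 2" "k \<ge> 2 * s"
  shows "card (power_edge k s e) = k"
proof -
  have "finite e"
    using assms(1) card.infinite by fastforce
  then show ?thesis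
    unfolding power_edge_def using assms
    by (subst card_Un_disjoint[OF finite_blocks vert_edge_blocks_disjoint])
      (simp_all add: card_vert_blocks card_edge_block)
qed

section \<open>Incidences, degrees and uniformity of the power hypergraph\<close>

lemma power_edges_incident:
  assumes "simple_graph V E"
  shows "{e \<in> power_edges E k s. i \<in> e} = power_edge k s ` {e \<in> E. i \<in> power_edge k s e}"
  using power_edges_eq_image[OF assms, of k s] by auto

lemma degree_power_edges:
  assumes "simple_graph V E" "s \<ge> 1"
  shows "degree (power_edges E k s) i = card {e \<in> E. i \<in> power_edge k s e}"
  unfolding degree_def power_edges_incident[OF assms(1)]
  using inj_power_edge[OF assms(2)] by (intro card_image) (auto intro: inj_on_subset)

lemma degree_power_edges_Vert_Copy:
  assumes "simple_graph V E" "s \<ge> 1" "i < s"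
  shows "degree (power_edges E k s) (Vert_Copy v i) = degree E v"
  using assms by (simp add: degree_power_edges) (simp add: degree_def)

lemma degree_power_edges_Edge_Copy:
  assumes "simple_graph V E" "s \<ge> 1" "e \<in> E" "i < k - 2 * s"
  shows "degree (power_edges E k s) (Edge_Copy e i) = 1"
proof -
  have "{f \<in> E. e = f} = {e}" using assms by auto
  then show ?thesis using assms by (simp add: degree_power_edges)
qed

lemma finite_power_vertices:
  assumes "simple_graph V E"
  shows "finite E" "finite (power_vertices V E k s)"
proof -
  have "E \<subseteq> Pow V" "finite V"
    using assms by (auto simp: simple_graph_def)
  then show "finite E"
    by (meson finite_Pow_iff finite_subset)
  then show "finite (power_vertices V E k s)"
    using \<open>finite V\<close> by (auto simp: power_vertices_def vert_block_def edge_block_def)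
qed

lemma power_edges_uniform:
  assumes "simple_graph V E" "k \<ge> 2 * s" "e \<in> power_edges E k s"
  shows "e \<subseteq> power_vertices V E k s \<and> card e = k"
proof -
  obtain f where f: "e = power_edge k s f" "f \<in> E"
    using assms power_edges_eq_image by blast
  then have "f \<subseteq> V" "card f = 2"
    using assms(1) by (auto simp: simple_graph_def)
  then show ?thesis
    using f assms(2) by (auto simp: card_power_edge) (auto simp: power_edge_def power_vertices_def)
qed

lemma sum_power_edges_incident:
  assumes "simple_graph V E" "s \<ge> 1"
  shows "(\<Sum>e | e \<in> power_edges E k s \<and> i \<in> e. g e) =
    (\<Sum>e | e \<in> E \<and> i \<in> power_edge k s e. g (power_edge k s e))"
  unfolding power_edges_incident[OF assms(1)]
  by (rule sum.reindex_cong[OF inj_on_subset[OF inj_power_edge[OF assms(2)]]]) auto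

lemma degree_le_max_degree:
  assumes "simple_graph V E" "v \<in> V"
  shows "degree E v \<le> max_degree V E"
  using assms by (auto simp: simple_graph_def max_degree_def)

lemma max_degree_attained:
  assumes "simple_graph V E"
  obtains v where "v \<in> V" "degree E v = max_degree V E"
proof -
  have "max_degree V E \<in> degree E ` V"
    unfolding max_degree_def using assms by (intro Max_in) (auto simp: simple_graph_def)
  then show thesis using that by auto
qed

section \<open>Bounds for the largest eigenvalue\<close>

text \<open>Lower bound for the largest eigenvalue: a copy of a vertex of maximum degree has that
  same degree in the power hypergraph.\<close>

lemma max_degree_H_eigenvalue:
  assumes "simple_graph V E" "s \<ge> 1" "k \<ge> 2 * s" "k \<ge> 3"
  shows "H_eigenvalue (power_vertices V E k s) k
    (signless_laplacian_tensor k (power_edges E k s)) (real (max_degree V E))"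
proof -
  obtain v where v: "v \<in> V" "degree E v = max_degree V E"
    using max_degree_attained[OF assms(1)] .
  have "Vert_Copy v 0 \<in> power_vertices V E k s"
    using v(1) assms(2) by (force simp: power_vertices_def vert_block_def)
  moreover have "finite (power_edges E k s)"
    using assms(1) by (simp add: power_edges_eq_image finite_power_vertices(1))
  ultimately have "H_eigenvalue (power_vertices V E k s) k
      (signless_laplacian_tensor k (power_edges E k s)) (degree (power_edges E k s) (Vert_Copy v 0))"
    using assms power_edges_uniform finite_power_vertices(2)
    by (intro degree_H_eigenvalue_signless_laplacian) blast+
  then show ?thesis
    using v assms by (simp add: degree_power_edges_Vert_Copy)
qed

text \<open>For fixed \<open>s\<close> and \<epsilon> the right side does not depend on
  \<open>k\<close>, while the left side grows geometrically in \<open>k\<close>.\<close>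

lemma large_H_eigenvalue_power_bound:
  assumes G: "simple_graph V E" and \<Delta>: "max_degree V E > 1"
    and s: "s \<ge> 1" and k: "k \<ge> 2 * s" and \<epsilon>: "\<epsilon> > 0"
    and eig: "H_eigenvalue (power_vertices V E k s) k
      (signless_laplacian_tensor k (power_edges E k s)) l"
    and l: "l \<ge> real (max_degree V E) + \<epsilon>"
  shows "(1 + \<epsilon>) ^ (k - 2 * s) \<le> (real (max_degree V E) / \<epsilon>) ^ (2 * s)"
proof -
  define N where "N = power_vertices V E k s"
  define D where "D = real (max_degree V E)"
  obtain x where nz: "\<exists>i\<in>N. x i \<noteq> 0"
    and x: "\<And>i. i \<in> N \<Longrightarrow> tensor_apply N k (signless_laplacian_tensor k (power_edges E k s)) x i
       = l * x i ^ (k - 1)"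
    using eig unfolding H_eigenvalue_def N_def by blast
  define P where "P = (\<lambda>e. \<bar>\<Prod>j\<in>power_edge k s e. x j\<bar>)"
  have finE: "finite E" and finN: "finite N"
    using finite_power_vertices[OF G] by (auto simp: N_def)
  have P0: "P e \<ge> 0" for e
    by (simp add: P_def)
  have D2: "D \<ge> 2"
    using \<Delta> by (simp add: D_def)
  have eqn: "(l - real (degree (power_edges E k s) i)) * x i ^ k =
      (\<Sum>e | e \<in> E \<and> i \<in> power_edge k s e. \<Prod>j\<in>power_edge k s e. x j)" if "i \<in> N" for i
  proof -
    have "(l - real (degree (power_edges E k s) i)) * x i ^ k =
        (\<Sum>e | e \<in> power_edges E k s \<and> i \<in> e. \<Prod>j\<in>e. x j)"
      using finN that s k finE power_edges_uniform[OF G k] x[OF that]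
      by (intro signless_laplacian_eigenequation[of N])
        (auto simp: power_edges_eq_image[OF G] N_def)
    then show ?thesis
      by (simp add: sum_power_edges_incident[OF G s])
  qed
  \<comment> \<open>A vertex of degree one lies in a single edge, so its equation has one term on
    the right; \<open>l - 1\<close> is positive and passes through the absolute value.\<close>
  have edge_eq: "(l - 1) * \<bar>x (Edge_Copy e i)\<bar> ^ k = P e" if "e \<in> E" "i < k - 2 * s" for e i
  proof -
    have "Edge_Copy e i \<in> N"
      using that by (auto simp: N_def power_vertices_def edge_block_def)
    moreover have "{f \<in> E. e = f} = {e}" using that by auto
    ultimately have "(l - 1) * x (Edge_Copy e i) ^ k = (\<Prod>j\<in>power_edge k s e. x j)"
      using eqn[of "Edge_Copy e i"] that degree_power_edges_Edge_Copy[OF G s that] by simp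
    then have "\<bar>(l - 1) * x (Edge_Copy e i) ^ k\<bar> = P e"
      by (simp add: P_def)
    then show ?thesis
      using l \<epsilon> D2 by (simp add: abs_mult power_abs D_def)
  qed
  obtain v where "degree E v = max_degree V E"
    using max_degree_attained[OF G] .
  \<comment> \<open>Some edge must exist for the maximum of \<open>P\<close> to make sense.\<close>
  then have "E \<noteq> {}"
    using \<Delta> by (auto simp: degree_def)
  then have "Max (P ` E) \<in> P ` E"
    using finE by (intro Max_in) auto
  then obtain e where e: "e \<in> E" "P e = Max (P ` E)"
    by auto
  have Pmax: "P f \<le> P e" if "f \<in> E" for f
    unfolding e(2) using that finE by simp
  \<comment> \<open>The triangle inequality bounds the right side of the equation by at most
    \<open>D\<close> terms of size at most \<open>P e\<close>; on the left,
    \<open>l - degree E v\<close> is at least \<epsilon>.\<close>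
  have vert_le: "\<bar>x (Vert_Copy v i)\<bar> ^ k \<le> D * P e / \<epsilon>" if "v \<in> V" "i < s" for v i
  proof -
    have deg: "real (degree E v) \<le> D"
      using degree_le_max_degree[OF G that(1)] by (simp add: D_def)
    have "Vert_Copy v i \<in> N"
      using that by (auto simp: N_def power_vertices_def vert_block_def)
    from eqn[OF this] have "(l - degree E v) * x (Vert_Copy v i) ^ k =
        (\<Sum>f | f \<in> E \<and> v \<in> f. \<Prod>j\<in>power_edge k s f. x j)"
      using that by (simp add: degree_power_edges_Vert_Copy[OF G s])
    then have "\<bar>(l - degree E v) * x (Vert_Copy v i) ^ k\<bar> \<le> (\<Sum>f | f \<in> E \<and> v \<in> f. P f)"
      by (simp add: P_def)
    also have "\<dots> \<le> degree E v * P e"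
      unfolding degree_def using Pmax by (intro sum_bounded_above) auto
    also have "\<dots> \<le> D * P e"
      using deg P0 by (intro mult_right_mono)
    finally have "(l - degree E v) * \<bar>x (Vert_Copy v i)\<bar> ^ k \<le> D * P e"
      using l \<epsilon> deg by (simp add: abs_mult power_abs D_def)
    moreover have "\<epsilon> * \<bar>x (Vert_Copy v i)\<bar> ^ k \<le> (l - degree E v) * \<bar>x (Vert_Copy v i)\<bar> ^ k"
      using l deg by (intro mult_right_mono) (auto simp: D_def)
    ultimately show ?thesis
      using \<epsilon> by (simp add: field_simps)
  qed
  have k0: "k > 0" using s k by simp
  \<comment> \<open>Otherwise the two kinds of bounds force every coordinate to vanish. Positivity
    permits cancelling \<open>P e ^ k\<close> at the end.\<close>
  have "P e > 0"
  proof (rule ccontr)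
    assume "\<not> P e > 0"
    then have Pe: "P e = 0" using P0[of e] by simp
    have "x i = 0" if "i \<in> N" for i
    proof (cases i)
      case (Vert_Copy v m)
      then have "v \<in> V" "m < s"
        using that by (auto simp: N_def power_vertices_def vert_block_def edge_block_def)
      from vert_le[OF this] show ?thesis
        using Pe k0 Vert_Copy by (auto simp: power_le_zero_eq)
    next
      case (Edge_Copy f m)
      then have fm: "f \<in> E" "m < k - 2 * s"
        using that by (auto simp: N_def power_vertices_def vert_block_def edge_block_def)
      have "P f = 0" using Pmax[OF fm(1)] Pe P0[of f] by simp
      then show ?thesis
        using edge_eq[OF fm] k0 Edge_Copy l \<epsilon> D2 by (auto simp: D_def)
    qed
    then show False using nz by auto
  qed
  have eV: "e \<subseteq> V" "card e = 2" and fe: "finite e"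
    using e(1) G by (auto simp: simple_graph_def intro: finite_subset)
  have "P e ^ k = (\<Prod>j\<in>power_edge k s e. \<bar>x j\<bar> ^ k)"
    by (simp add: P_def abs_prod prod_power_distrib)
  also have "\<dots> = (\<Prod>j\<in>(\<Union>v\<in>e. vert_block s v). \<bar>x j\<bar> ^ k) * (\<Prod>j\<in>edge_block k s e. \<bar>x j\<bar> ^ k)"
    unfolding power_edge_def using fe
    by (intro prod.union_disjoint finite_blocks vert_edge_blocks_disjoint)
  also have "(\<Prod>j\<in>edge_block k s e. \<bar>x j\<bar> ^ k) = (\<Prod>j\<in>edge_block k s e. P e / (l - 1))"
    using edge_eq[OF e(1)] l \<epsilon> D2
    by (intro prod.cong) (auto simp: edge_block_def D_def field_simps)
  also have "\<dots> = (P e / (l - 1)) ^ (k - 2 * s)"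
    by (simp add: card_edge_block)
  also have "(\<Prod>j\<in>(\<Union>v\<in>e. vert_block s v). \<bar>x j\<bar> ^ k) \<le> (\<Prod>j\<in>(\<Union>v\<in>e. vert_block s v). D * P e / \<epsilon>)"
    using vert_le eV by (intro prod_mono) (auto simp: vert_block_def)
  also have "\<dots> = (D * P e / \<epsilon>) ^ (2 * s)"
    by (simp add: card_vert_blocks[OF fe] eV)
  finally have "P e ^ k \<le> (D * P e / \<epsilon>) ^ (2 * s) * (P e / (l - 1)) ^ (k - 2 * s)"
    using P0[of e] l \<epsilon> D2 by (simp add: D_def mult_right_mono)
  also have "\<dots> = (D / \<epsilon>) ^ (2 * s) * (P e ^ (2 * s) * P e ^ (k - 2 * s)) / (l - 1) ^ (k - 2 * s)"
    by (simp add: power_mult_distrib power_divide)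
  \<comment> \<open>The block sizes add up to \<open>k\<close>, so \<open>P e\<close> enters both
    sides with the same power.\<close>
  also have "P e ^ (2 * s) * P e ^ (k - 2 * s) = P e ^ k"
    using k by (simp flip: power_add)
  finally have "(l - 1) ^ (k - 2 * s) * P e ^ k \<le> (D / \<epsilon>) ^ (2 * s) * P e ^ k"
    using l \<epsilon> D2 by (simp add: D_def field_simps)
  then have "(l - 1) ^ (k - 2 * s) \<le> (D / \<epsilon>) ^ (2 * s)"
    using \<open>P e > 0\<close> by simp
  \<comment> \<open>Maximum degree at least 2 gives \<open>l - 1\<close> at least 1 + \<epsilon>, a
    base strictly above 1 and independent of \<open>l\<close>.\<close>
  moreover have "(1 + \<epsilon>) ^ (k - 2 * s) \<le> (l - 1) ^ (k - 2 * s)"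
    using l \<epsilon> D2 by (intro power_mono) (auto simp: D_def)
  ultimately show ?thesis by (simp add: D_def)
qed

text \<open>The threshold for \<open>k\<close> is the same for all eigenvalues \<open>l\<close>.
  Hence this yields both the upper estimate for the limit and the boundedness that makes the largest
  eigenvalue exist.\<close>

lemma eventually_H_eigenvalues_less:
  assumes "simple_graph V E" "max_degree V E > 1" "s \<ge> 1" "\<epsilon> > 0"
  shows "\<forall>\<^sub>F k in sequentially. \<forall>l. H_eigenvalue (power_vertices V E k s) k
    (signless_laplacian_tensor k (power_edges E k s)) l \<longrightarrow> l < real (max_degree V E) + \<epsilon>"
proof -
  obtain n where n: "(real (max_degree V E) / \<epsilon>) ^ (2 * s) < (1 + \<epsilon>) ^ n"
    using real_arch_pow[of "1 + \<epsilon>"] assms(4) by auto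
  have "l < real (max_degree V E) + \<epsilon>"
    if k: "k \<ge> n + 2 * s" and "H_eigenvalue (power_vertices V E k s) k
      (signless_laplacian_tensor k (power_edges E k s)) l" for k l
  proof (rule ccontr)
    assume "\<not> l < real (max_degree V E) + \<epsilon>"
    then have "(1 + \<epsilon>) ^ (k - 2 * s) \<le> (real (max_degree V E) / \<epsilon>) ^ (2 * s)"
      using assms that by (intro large_H_eigenvalue_power_bound[of V E s k \<epsilon> l]) auto
    moreover have "(1 + \<epsilon>) ^ n \<le> (1 + \<epsilon>) ^ (k - 2 * s)"
      using assms(4) k by (intro power_increasing) auto
    ultimately show False using n by simp
  qed
  then show ?thesis
    unfolding eventually_sequentially by blast
qed

theorem theorem4p12:
  fixes V :: "'a set" and E :: "'a set set" and s :: nat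
  assumes "simple_graph V E"
    and "max_degree V E > 1"
    and "s \<ge> 1"
  shows "(\<lambda>k. largest_H_eigenvalue (power_vertices V E k s) k
            (signless_laplacian_tensor k (power_edges E k s)))
         \<longlonglongrightarrow> real (max_degree V E)"
proof (rule tendstoI)
  fix \<epsilon> :: real assume \<epsilon>: "\<epsilon> > 0"
  show "\<forall>\<^sub>F k in sequentially. dist (largest_H_eigenvalue (power_vertices V E k s) k
      (signless_laplacian_tensor k (power_edges E k s))) (real (max_degree V E)) < \<epsilon>"
    using eventually_H_eigenvalues_less[OF assms \<epsilon>] eventually_ge_at_top[of "2 * s"]
      eventually_ge_at_top[of 3]
  proof eventually_elim
    case (elim k)
    let ?N = "power_vertices V E k s"
    let ?Q = "signless_laplacian_tensor k (power_edges E k s)"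
    have \<Delta>: "H_eigenvalue ?N k ?Q (real (max_degree V E))"
      using assms elim by (intro max_degree_H_eigenvalue) auto
    \<comment> \<open>The largest eigenvalue is attained, so the strict upper bound in
      \<open>elim(1)\<close> applies to it directly.\<close>
    have "H_eigenvalue ?N k ?Q (largest_H_eigenvalue ?N k ?Q)"
      "real (max_degree V E) \<le> largest_H_eigenvalue ?N k ?Q"
      using largest_H_eigenvalue_exists[OF finite_power_vertices(2)[OF assms(1)] \<Delta>]
        elim(1) \<Delta> less_imp_le by blast+
    then show ?case
      using elim(1) by (auto simp: dist_real_def)
  qed
qed

end
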